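(* Let $A$ and $B$ be infinite Boolean algebras with $\omega_1\leq\mathfrak{a}(A)$ and $\omega_1\le\mathfrak{a}(B)$. Then $\min\{\mathfrak{b}(A),\mathfrak{b}(B)\}\leq\mathfrak{a}(A\oplus B)$.
   Context: For a Boolean algebra $A$, $A^+=A\setminus\{0\}$. A partition of $A$ is a set $P\subseteq A^+$ of pairwise disjoint elements such that every $x\in A^+$ meets some element of $P$; $\mathfrak{a}(A)$ is the least size of an infinite partition of $A$. A pair $(\mathcal{A},\mathcal{B})$ with $\mathcal{A},\mathcal{B}\subseteq A^+$ is a Rothberger gap if $|\mathcal{A}|=\omega$, $a\cdot b=0$ for all $a\in\mathcal{A}$, $b\in\mathcal{B}$, and there is no $c\in A^+$ with $a\cdot c=0$ for all $a\in\mathcal{A}$ and $b\le c$ for all $b\in\mathcal{B}$. When a Rothberger gap exists in $A$ (which is the case when $\mathfrak{a}(A)\ge\omega_1$), $\mathfrak{b}(A)$ is the least $|\mathcal{B}|$ such that $(\mathcal{A},\mathcal{B})$ is a Rothberger gap for some $\mathcal{A}$. $A\oplus B$ is the free product of $A$ and $B$ (the Boolean algebra generated by copies of $A$ and $B$ in which every nonzero element of the copy of $A$ meets every nonzero element of the copy of $B$; dually, the clopen algebra of the product of the Stone spaces). *)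

theory Defs
  imports Main
begin

unbundle lattice_syntax and cardinal_syntax

text \<open>
  A Boolean algebra is a type of class \<open>boolean_algebra\<close>; cardinals are the cardinal
  orders of the library, which are compared across types by \<open>\<le>o\<close>.
\<close>

definition is_partition :: "'a::boolean_algebra set \<Rightarrow> bool" where
  "is_partition P \<longleftrightarrow>
     \<bottom> \<notin> P \<and>
     pairwise (\<lambda>p q. p \<sqinter> q = \<bottom>) P \<and>
     (\<forall>x. x \<noteq> \<bottom> \<longrightarrow> (\<exists>p\<in>P. x \<sqinter> p \<noteq> \<bottom>))"

text \<open>
  In a Rothberger gap the second side is required to be nonempty. Without this, every
  countably infinite set of nonzero elements containing \<open>\<top>\<close> would form a gap together with
  the empty set, and the least size of a second side would always be \<open>0\<close>. Equivalently, one
  could leave \<open>\<B>\<close> unrestricted and let the separating element \<open>c\<close> be \<open>\<bottom>\<close>.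
\<close>

definition rothberger_gap ::
  "'a::boolean_algebra set \<Rightarrow> 'a set \<Rightarrow> bool" where
  "rothberger_gap \<A> \<B> \<longleftrightarrow>
     \<bottom> \<notin> \<A> \<and> \<bottom> \<notin> \<B> \<and> \<B> \<noteq> {} \<and>
     |\<A>| =o natLeq \<and>
     (\<forall>a\<in>\<A>. \<forall>b\<in>\<B>. a \<sqinter> b = \<bottom>) \<and>
     \<not> (\<exists>c. c \<noteq> \<bottom> \<and> (\<forall>a\<in>\<A>. a \<sqinter> c = \<bottom>) \<and> (\<forall>b\<in>\<B>. b \<le> c))"

text \<open>Only meaningful for a nonempty family; a member of least size exists then because
  \<open><o\<close> is well-founded.\<close>

definition least_card :: "'a set set \<Rightarrow> 'a rel" where
  "least_card \<S> = |SOME S. S \<in> \<S> \<and> (\<forall>T\<in>\<S>. |S| \<le>o |T| )|"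

definition cardinal_a :: "'a::boolean_algebra itself \<Rightarrow> 'a rel" where
  "cardinal_a _ = least_card {P. is_partition P \<and> infinite P}"

definition cardinal_b :: "'a::boolean_algebra itself \<Rightarrow> 'a rel" where
  "cardinal_b _ = least_card {\<B>. \<exists>\<A>. rothberger_gap \<A> \<B>}"

text \<open>The minimum of two cardinals on different types, moved to the sum type.\<close>

definition card_min :: "'a rel \<Rightarrow> 'b rel \<Rightarrow> ('a + 'b) rel" where
  "card_min r s = (if r \<le>o s then dir_image r Inl else dir_image s Inr)"

abbreviation omega1 :: "nat set rel" where
  "omega1 \<equiv> cardSuc natLeq"

definition boolean_embedding ::
  "('a::boolean_algebra \<Rightarrow> 'c::boolean_algebra) \<Rightarrow> bool" where
  "boolean_embedding h \<longleftrightarrow>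
     inj h \<and> h \<bottom> = \<bottom> \<and> h \<top> = \<top> \<and>
     (\<forall>x y. h (x \<sqinter> y) = h x \<sqinter> h y) \<and>
     (\<forall>x y. h (x \<squnion> y) = h x \<squnion> h y) \<and>
     (\<forall>x. h (- x) = - h x)"

inductive_set generated_subalgebra :: "'c::boolean_algebra set \<Rightarrow> 'c set"
  for G :: "'c set" where
  base: "x \<in> G \<Longrightarrow> x \<in> generated_subalgebra G"
| bot: "\<bottom> \<in> generated_subalgebra G"
| compl: "x \<in> generated_subalgebra G \<Longrightarrow> - x \<in> generated_subalgebra G"
| meet: "x \<in> generated_subalgebra G \<Longrightarrow> y \<in> generated_subalgebra G
    \<Longrightarrow> x \<sqinter> y \<in> generated_subalgebra G"

text \<open>The algebra \<open>'c\<close>, with the embeddings \<open>i\<close> and \<open>j\<close>, is the free product of \<open>'a\<close> and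
  \<open>'b\<close>. This determines \<open>'c\<close>, \<open>i\<close> and \<open>j\<close> up to isomorphism.\<close>

definition is_free_product ::
  "('a::boolean_algebra \<Rightarrow> 'c::boolean_algebra) \<Rightarrow> ('b::boolean_algebra \<Rightarrow> 'c) \<Rightarrow> bool" where
  "is_free_product i j \<longleftrightarrow>
     boolean_embedding i \<and> boolean_embedding j \<and>
     generated_subalgebra (range i \<union> range j) = UNIV \<and>
     (\<forall>a b. a \<noteq> \<bottom> \<longrightarrow> b \<noteq> \<bottom> \<longrightarrow> i a \<sqinter> j b \<noteq> \<bottom>)"

end

theory Submission
  imports Defs
begin

text \<open>
  Refine an infinite partition of the free product to a partition \<open>R\<close> into rectangles
  \<open>x \<times> y\<close>, and suppose that no Rothberger gap of \<open>'a\<close> or \<open>'b\<close> has a second side of size at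
  most \<open>|R|\<close>. Since there are no countably infinite partitions, decreasing sequences of nonzero
  elements have nonzero lower bounds. Together with the separation of countable families from
  families of size \<open>|R|\<close> this gives, for a disjoint sequence \<open>a\<close> and a family \<open>E\<close> of
  size at most \<open>|R|\<close> each of whose members meets only finitely many \<open>a n\<close>, a nonzero
  element disjoint from all members of \<open>E\<close>: separate the sequence from all
  \<open>p - (\<Squnion>n\<in>F. a n)\<close>, where \<open>p \<in> E\<close> and \<open>F\<close> indexes the terms meeting \<open>p\<close>, and then
  go below the complements of the separating element and of the \<open>a n\<close>.

  If infinitely many rectangles have sides above one nonzero \<open>v\<close>, their other sides are
  disjoint, and such an escaping element yields a rectangle disjoint from all of \<open>R\<close>.
  Otherwise, infinitely many members of \<open>R\<close> can be shrunk to rectangles \<open>a n \<times> b n\<close> with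
  disjoint \<open>a n\<close> and disjoint \<open>b n\<close>. As long as some \<open>x \<times> y \<in> R\<close> meets infinitely many
  \<open>a n\<close> and infinitely many \<open>b n\<close>, replace \<open>a n\<close> by \<open>a n \<sqinter> x\<close>, keeping
  the \<open>n\<close> for which this is nonzero. Repeated infinitely often, this produces infinitely many \<open>x\<close> with a common nonzero lower bound. So it stops, and
  escaping in both factors gives a rectangle disjoint from all of \<open>R\<close>.
\<close>

subsection \<open>Separation and lower bounds\<close>

text \<open>This is \<sigma>-closedness of the nonzero elements as a forcing order, not closure
  under countable joins.\<close>

definition sigma_closed :: "'a::boolean_algebra itself \<Rightarrow> bool" where
  "sigma_closed _ \<longleftrightarrow> (\<forall>d::nat \<Rightarrow> 'a. (\<forall>n. d n \<noteq> \<bottom> \<and> d (Suc n) \<le> d n) \<longrightarrow>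
     (\<exists>v. v \<noteq> \<bottom> \<and> (\<forall>n. v \<le> d n)))"

text \<open>Indexing by an infinite set \<open>M\<close> lets a sequence be thinned out without
  renumbering. The bound \<open>\<kappa>\<close> may live on any type, so that \<open>|R|\<close>
  serves for both factors.\<close>

definition escapable :: "'a::boolean_algebra itself \<Rightarrow> 'k rel \<Rightarrow> bool" where
  "escapable _ \<kappa> \<longleftrightarrow> (\<forall>(a::nat \<Rightarrow> 'a) M E.
     infinite M \<longrightarrow> \<bottom> \<notin> a ` M \<longrightarrow> pairwise (\<lambda>m n. a m \<sqinter> a n = \<bottom>) M \<longrightarrow>
     |E| \<le>o \<kappa> \<longrightarrow> (\<forall>p\<in>E. finite {n \<in> M. a n \<sqinter> p \<noteq> \<bottom>}) \<longrightarrow>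
     (\<exists>z. z \<noteq> \<bottom> \<and> (\<forall>p\<in>E. z \<sqinter> p = \<bottom>)))"

lemma sigma_closedD:
  fixes d :: "nat \<Rightarrow> 'a::boolean_algebra"
  assumes "sigma_closed TYPE('a)" "\<And>n. d n \<noteq> \<bottom>" "\<And>n. d (Suc n) \<le> d n"
  obtains v where "v \<noteq> \<bottom>" "\<And>n. v \<le> d n"
  using assms unfolding sigma_closed_def by blast

lemma escapableD:
  fixes a :: "nat \<Rightarrow> 'a::boolean_algebra"
  assumes "escapable TYPE('a) \<kappa>" "infinite M" "\<And>n. n \<in> M \<Longrightarrow> a n \<noteq> \<bottom>"
    "pairwise (\<lambda>m n. a m \<sqinter> a n = \<bottom>) M"
    "|E| \<le>o \<kappa>" "\<And>p. p \<in> E \<Longrightarrow> finite {n \<in> M. a n \<sqinter> p \<noteq> \<bottom>}"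
  shows "\<exists>z. z \<noteq> \<bottom> \<and> (\<forall>p\<in>E. z \<sqinter> p = \<bottom>)"
proof -
  have "\<bottom> \<notin> a ` M"
    using assms(3) by force
  then show ?thesis
    using assms unfolding escapable_def by meson
qed

text \<open>The two properties make \<open>s\<close> the join of the family: leastness is expressed
  through disjointness, an upper bound \<open>t\<close> being covered by the case
  \<open>y = - t\<close>.\<close>

lemma finite_join:
  fixes a :: "'i \<Rightarrow> 'a::boolean_algebra"
  assumes "finite F"
  shows "\<exists>s. (\<forall>n\<in>F. a n \<le> s) \<and> (\<forall>y. (\<forall>n\<in>F. y \<sqinter> a n = \<bottom>) \<longrightarrow> y \<sqinter> s = \<bottom>)"
  using assms
proof induction
  case empty
  then show ?case by (auto intro: exI[of _ \<bottom>])
next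
  case (insert k F)
  then obtain s where "\<forall>n\<in>F. a n \<le> s" "\<forall>y. (\<forall>n\<in>F. y \<sqinter> a n = \<bottom>) \<longrightarrow> y \<sqinter> s = \<bottom>"
    by blast
  then show ?case
    by (intro exI[of _ "a k \<squnion> s"]) (auto simp: inf_sup_distrib1 intro: le_supI2)
qed

text \<open>Subtract the terms \<open>a n\<close> one after another from \<open>- c\<close>. What is
  left at stage \<open>n\<close> still lies above all terms from index \<open>n\<close> on, so it is
  nonzero, and any nonzero lower bound of the stages works.\<close>

lemma sigma_closed_avoid:
  fixes a :: "nat \<Rightarrow> 'a::boolean_algebra"
  assumes sc: "sigma_closed TYPE('a)" and inf: "infinite M"
    and nz: "\<And>n. n \<in> M \<Longrightarrow> a n \<noteq> \<bottom>"
    and disj: "pairwise (\<lambda>m n. a m \<sqinter> a n = \<bottom>) M"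
    and c: "\<And>n. n \<in> M \<Longrightarrow> a n \<sqinter> c = \<bottom>"
  obtains z where "z \<noteq> \<bottom>" "z \<sqinter> c = \<bottom>" "\<And>n. n \<in> M \<Longrightarrow> z \<sqinter> a n = \<bottom>"
proof -
  define d where "d = rec_nat (- c) (\<lambda>n x. x \<sqinter> (if n \<in> M then - a n else \<top>))"
  have d0: "d 0 = - c" and dS: "d (Suc n) = d n \<sqinter> (if n \<in> M then - a n else \<top>)" for n
    by (simp_all add: d_def)
  have tail: "\<forall>m\<in>M. n \<le> m \<longrightarrow> a m \<le> d n" for n
  proof (induction n)
    case 0
    then show ?case using c by (simp add: d0 inf_shunt)
  next
    case (Suc n)
    have "a m \<le> - a n" if "m \<in> M" "n \<in> M" "Suc n \<le> m" for m
      using disj that unfolding inf_shunt[symmetric] pairwise_def by auto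
    with Suc show ?case by (auto simp: dS)
  qed
  have "d n \<noteq> \<bottom>" for n
  proof -
    obtain m where "m \<in> M" "n \<le> m"
      using inf unfolding finite_nat_set_iff_bounded_le by (meson nat_le_linear)
    with tail[of n] nz[of m] show ?thesis
      by (metis bot.extremum_uniqueI)
  qed
  then obtain v where v: "v \<noteq> \<bottom>" "\<And>n. v \<le> d n"
    using sigma_closedD[OF sc, of d] by (auto simp: dS)
  have "v \<sqinter> a n = \<bottom>" if "n \<in> M" for n
    using v(2)[of "Suc n"] that by (simp add: dS inf_shunt)
  then show ?thesis
    using that v d0 by (metis inf_shunt)
qed

text \<open>The hypothesis \<open>sep\<close> is the absence of gaps bounded by
  \<open>\<kappa>\<close>, with \<bottom> allowed in \<open>\<B>\<close> and as \<open>c\<close>: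
  the differences \<open>p \<sqinter> - s p\<close> separated below can vanish.\<close>

lemma escapableI:
  assumes sc: "sigma_closed TYPE('a::boolean_algebra)"
    and sep: "\<And>(a :: nat \<Rightarrow> 'a) M \<B>. infinite M \<Longrightarrow> \<bottom> \<notin> a ` M \<Longrightarrow>
      pairwise (\<lambda>m n. a m \<sqinter> a n = \<bottom>) M \<Longrightarrow> |\<B>| \<le>o \<kappa> \<Longrightarrow>
      (\<forall>n\<in>M. \<forall>b\<in>\<B>. a n \<sqinter> b = \<bottom>) \<Longrightarrow>
      \<exists>c. (\<forall>n\<in>M. a n \<sqinter> c = \<bottom>) \<and> (\<forall>b\<in>\<B>. b \<le> c)"
  shows "escapable TYPE('a) \<kappa>"
  unfolding escapable_def
proof (intro allI impI)
  fix a :: "nat \<Rightarrow> 'a" and M E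
  assume M: "infinite M" "\<bottom> \<notin> a ` M" "pairwise (\<lambda>m n. a m \<sqinter> a n = \<bottom>) M"
    and E: "|E| \<le>o \<kappa>" "\<forall>p\<in>E. finite {n \<in> M. a n \<sqinter> p \<noteq> \<bottom>}"
  have "\<exists>s. (\<forall>n\<in>M. a n \<sqinter> p \<noteq> \<bottom> \<longrightarrow> a n \<le> s) \<and> (\<forall>y. (\<forall>n\<in>M. y \<sqinter> a n = \<bottom>) \<longrightarrow> y \<sqinter> s = \<bottom>)"
    if p: "p \<in> E" for p
  proof -
    have "finite {n \<in> M. a n \<sqinter> p \<noteq> \<bottom>}"
      using E(2) p by blast
    from finite_join[OF this, of a] show ?thesis
      by (rule ex_forward) auto
  qed
  then obtain s where s: "\<And>p n. p \<in> E \<Longrightarrow> n \<in> M \<Longrightarrow> a n \<sqinter> p \<noteq> \<bottom> \<Longrightarrow> a n \<le> s p"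
    "\<And>p y. p \<in> E \<Longrightarrow> (\<And>n. n \<in> M \<Longrightarrow> y \<sqinter> a n = \<bottom>) \<Longrightarrow> y \<sqinter> s p = \<bottom>"
    by metis
  have "|(\<lambda>p. p \<sqinter> - s p) ` E| \<le>o \<kappa>"
    using E(1) card_of_image ordLeq_transitive by blast
  moreover have "a n \<sqinter> (p \<sqinter> - s p) = \<bottom>" if "n \<in> M" "p \<in> E" for n p
  proof (cases "a n \<sqinter> p = \<bottom>")
    case True
    then show ?thesis by (metis inf_assoc inf_bot_left)
  next
    case False
    then have "a n \<sqinter> - s p = \<bottom>"
      using s(1) that by (simp add: inf_shunt)
    then show ?thesis by (metis inf_left_commute inf_bot_right)
  qed
  ultimately obtain c where "\<forall>n\<in>M. a n \<sqinter> c = \<bottom>" "\<forall>p\<in>E. p \<sqinter> - s p \<le> c"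
    using sep[OF M, of "(\<lambda>p. p \<sqinter> - s p) ` E"] by auto
  then have c: "\<And>n. n \<in> M \<Longrightarrow> a n \<sqinter> c = \<bottom>" "\<And>p. p \<in> E \<Longrightarrow> p \<sqinter> - s p \<le> c"
    by auto
  obtain z where z: "z \<noteq> \<bottom>" "z \<sqinter> c = \<bottom>" "\<And>n. n \<in> M \<Longrightarrow> z \<sqinter> a n = \<bottom>"
    using sigma_closed_avoid[OF sc M(1) _ M(3) c(1)] M(2) by (metis image_eqI)
  have "z \<sqinter> p = \<bottom>" if "p \<in> E" for p
  proof -
    have "z \<le> - s p"
      using s(2)[OF that z(3)] by (simp add: inf_shunt)
    then have "z \<sqinter> p \<le> z \<sqinter> (p \<sqinter> - s p)"
      by (simp add: le_infI1)
    also have "\<dots> \<le> z \<sqinter> c"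
      using c(2)[OF that] by (simp add: le_infI2)
    finally show ?thesis
      using z(2) bot.extremum_uniqueI by metis
  qed
  with z(1) show "\<exists>z. z \<noteq> \<bottom> \<and> (\<forall>p\<in>E. z \<sqinter> p = \<bottom>)"
    by blast
qed

text \<open>Suppose that no nonzero element lies below infinitely many \<open>b n\<close>, and
  choose disjoint pieces recursively. If \<open>u\<close> is the join of the pieces so far,
  infinitely many \<open>b n\<close> must remain not below \<open>u\<close>; each new piece is taken
  small enough for this to survive.\<close>

lemma common_lower_bound_or_disjoint_shrinking:
  fixes b :: "nat \<Rightarrow> 'a::boolean_algebra"
  assumes nz: "\<And>n. b n \<noteq> \<bottom>"
  obtains v where "v \<noteq> \<bottom>" "infinite {n. v \<le> b n}"
  | f b' where "strict_mono (f :: nat \<Rightarrow> nat)" "\<And>k. b' k \<noteq> \<bottom>" "\<And>k. b' k \<le> b (f k)"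
      "pairwise (\<lambda>m n. b' m \<sqinter> b' n = \<bottom>) UNIV"
proof (cases "\<exists>v. v \<noteq> \<bottom> \<and> infinite {n. v \<le> b n}")
  case True
  then show ?thesis using that(1) by blast
next
  case False
  then have fin: "finite {n. v \<le> b n}" if "v \<noteq> \<bottom>" for v
    using that by blast
  have step: "\<exists>m v. m \<in> M \<and> v \<noteq> \<bottom> \<and> v \<le> b m \<and> v \<sqinter> u = \<bottom> \<and> infinite {n \<in> M. \<not> b n \<le> u \<squnion> v}"
    if M: "infinite M" "\<forall>n\<in>M. \<not> b n \<le> u" for M u
  proof -
    obtain m where m: "m \<in> M" using M(1) by fastforce
    define v where "v = b m \<sqinter> - u"
    have v: "v \<noteq> \<bottom>" "v \<le> b m" "v \<sqinter> u = \<bottom>"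
      using m M(2) by (auto simp: v_def inf_shunt inf_assoc)
    show ?thesis
    proof (cases "infinite {n \<in> M. \<not> b n \<le> u \<squnion> v}")
      case True
      then show ?thesis using m v by blast
    next
      \<comment> \<open>Almost all \<open>b n\<close> with \<open>n \<in> M\<close> lie below
        \<open>u \<squnion> v\<close>, but only finitely many lie above \<open>v\<close>. So some
        \<open>b n\<close> cuts \<open>v\<close> into two nonzero pieces, one of which can replace
        \<open>v\<close>.\<close>
      case inside: False
      then have "infinite (M - {n \<in> M. \<not> b n \<le> u \<squnion> v} - {n. v \<le> b n})"
        using M(1) fin[OF v(1)] by (simp add: Diff_infinite_finite)
      then obtain n where n: "n \<in> M" "b n \<le> u \<squnion> v" "\<not> v \<le> b n"
        by (auto dest!: infinite_imp_nonempty)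
      have w: "v \<sqinter> - b n \<noteq> \<bottom>" "v \<sqinter> - b n \<le> b m" "v \<sqinter> - b n \<sqinter> u = \<bottom>"
        "v \<sqinter> b n \<noteq> \<bottom>" "v \<sqinter> b n \<le> b m" "v \<sqinter> b n \<sqinter> u = \<bottom>"
      proof -
        show "v \<sqinter> b n \<noteq> \<bottom>"
        proof
          assume "v \<sqinter> b n = \<bottom>"
          then have "b n \<le> (u \<squnion> v) \<sqinter> - v"
            using n(2) by (metis inf_commute inf_shunt le_inf_iff)
          then have "b n \<le> u"
            by (simp add: inf_sup_distrib2)
          with n(1) M(2) show False by blast
        qed
        show "v \<sqinter> - b n \<sqinter> u = \<bottom>" "v \<sqinter> b n \<sqinter> u = \<bottom>"
          using v(3) by (metis inf_commute inf_left_commute inf_bot_right)+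
              show "v \<sqinter> - b n \<noteq> \<bottom>"
          using n(3) by (simp add: inf_shunt)
        show "v \<sqinter> - b n \<le> b m" "v \<sqinter> b n \<le> b m"
          using v(2) by (simp_all add: le_infI1)
      qed
      \<comment> \<open>A \<open>b k\<close> below both joins would be below \<open>u\<close>. Hence
        each \<open>k \<in> M\<close> survives at least one choice of piece, and for one of the
        pieces infinitely many survive.\<close>
      have "{k \<in> M. b k \<le> u \<squnion> (v \<sqinter> b n)} \<inter> {k \<in> M. b k \<le> u \<squnion> (v \<sqinter> - b n)} = {}"
      proof -
        have "v \<sqinter> b n \<sqinter> (v \<sqinter> - b n) = \<bottom>"
          by (metis inf_assoc inf_bot_left inf_commute inf_compl_bot)
        then have "(u \<squnion> (v \<sqinter> b n)) \<sqinter> (u \<squnion> (v \<sqinter> - b n)) = u"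
          unfolding sup_inf_distrib1[symmetric] by simp
        then have "b k \<le> u" if "b k \<le> u \<squnion> (v \<sqinter> b n)" "b k \<le> u \<squnion> (v \<sqinter> - b n)" for k
          using le_infI[OF that] by simp
        then show ?thesis
          using M(2) by blast
      qed
      then have "M \<subseteq> {k \<in> M. \<not> b k \<le> u \<squnion> (v \<sqinter> b n)} \<union> {k \<in> M. \<not> b k \<le> u \<squnion> (v \<sqinter> - b n)}"
        by blast
      then have "infinite {k \<in> M. \<not> b k \<le> u \<squnion> (v \<sqinter> b n)} \<or> infinite {k \<in> M. \<not> b k \<le> u \<squnion> (v \<sqinter> - b n)}"
        using M(1) finite_subset by blast
      then show ?thesis
        using m w by blast
    qed
  qed
  \<comment> \<open>A stage records the indices \<open>M\<close> still available, the join
    \<open>u\<close> of the earlier pieces, and the chosen index \<open>m\<close> with its piece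
    \<open>v\<close> of \<open>b m\<close>.\<close>
  define P where "P = (\<lambda>(M, u, m, v). infinite M \<and> m \<in> M \<and> v \<noteq> \<bottom> \<and> v \<le> b m \<and> v \<sqinter> u = \<bottom> \<and>
      (\<forall>n\<in>M. \<not> b n \<le> u) \<and> infinite {n \<in> M. \<not> b n \<le> u \<squnion> v})"
  define Q :: "nat set \<times> 'a \<times> nat \<times> 'a \<Rightarrow> nat set \<times> 'a \<times> nat \<times> 'a \<Rightarrow> bool"
    where "Q = (\<lambda>(M, u, m, v) (M', u', m', v'). m < m' \<and> u' = u \<squnion> v)"
  have "\<exists>g. \<forall>n. P (g n) \<and> Q (g n) (g (Suc n))"
  proof (rule dependent_nat_choice)
    show "\<exists>x. P x"
    proof -
      obtain m v where "v \<noteq> \<bottom>" "v \<le> b m" "infinite {n. \<not> b n \<le> v}"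
        using step[of UNIV \<bottom>] nz by (auto simp: bot_unique)
      then have "P (UNIV, \<bottom>, m, v)"
        using nz by (auto simp: P_def bot_unique)
      then show ?thesis ..
    qed
  next
    fix x and k :: nat assume "P x"
    obtain M u m v where x: "x = (M, u, m, v)" by (cases x) auto
    \<comment> \<open>Dropping the indices up to \<open>m\<close> makes the chosen indices strictly
      increasing.\<close>
    let ?M = "{n \<in> M. \<not> b n \<le> u \<squnion> v} - {..m}"
    have "infinite ?M"
      using \<open>P x\<close> by (auto simp: P_def x)
    then obtain m' v' where "m' \<in> ?M" "v' \<noteq> \<bottom>" "v' \<le> b m'" "v' \<sqinter> (u \<squnion> v) = \<bottom>"
      "infinite {n \<in> ?M. \<not> b n \<le> u \<squnion> v \<squnion> v'}"
      using step[of ?M "u \<squnion> v"] by blast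
    with \<open>infinite ?M\<close> have "P (?M, u \<squnion> v, m', v')" "Q x (?M, u \<squnion> v, m', v')"
      by (simp_all add: P_def Q_def x)
    then show "\<exists>y. P y \<and> Q x y"
      by blast
  qed
  then obtain g where "\<And>n. P (g n)" "\<And>n. Q (g n) (g (Suc n))"
    by blast
  moreover define m u v where "m n = fst (snd (snd (g n)))" and "u n = fst (snd (g n))"
    and "v n = snd (snd (snd (g n)))" for n
  ultimately have props: "m n < m (Suc n)" "u (Suc n) = u n \<squnion> v n" "v n \<noteq> \<bottom>"
    "v n \<le> b (m n)" "v n \<sqinter> u n = \<bottom>" for n
    unfolding P_def Q_def by (auto simp: case_prod_beta)
  have le: "v i \<le> u j" if "i < j" for i j
    using that
  proof (induction j)
    case (Suc j)
    then show ?case by (cases "i = j") (auto simp: props(2) less_Suc_eq intro: le_supI1)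
  qed simp
  have "v i \<sqinter> v j = \<bottom>" if "i < j" for i j
    using le[OF that] props(5)[of j] by (metis inf.absorb_iff1 inf_assoc inf_bot_right inf_commute)
  then have "pairwise (\<lambda>m n. v m \<sqinter> v n = \<bottom>) UNIV"
    by (auto simp: pairwise_def inf_commute) (metis inf_commute nat_neq_iff)
  with props show ?thesis
    using that(2)[of m v] by (simp add: strict_mono_Suc_iff)
qed

subsection \<open>Partitions into rectangles\<close>

text \<open>A pair stands for the rectangle \<open>i (fst p) \<sqinter> j (snd p)\<close>, but only
  the factors are mentioned. Testing maximality against rectangles suffices, since every nonzero
  element of a free product contains a nonzero one.\<close>

definition rectangle_partition :: "('a::boolean_algebra \<times> 'b::boolean_algebra) set \<Rightarrow> bool" where
  "rectangle_partition R \<longleftrightarrow>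
     (\<forall>p\<in>R. fst p \<noteq> \<bottom> \<and> snd p \<noteq> \<bottom>) \<and>
     pairwise (\<lambda>p q. fst p \<sqinter> fst q = \<bottom> \<or> snd p \<sqinter> snd q = \<bottom>) R \<and>
     (\<forall>x y. x \<noteq> \<bottom> \<longrightarrow> y \<noteq> \<bottom> \<longrightarrow> (\<exists>p\<in>R. x \<sqinter> fst p \<noteq> \<bottom> \<and> y \<sqinter> snd p \<noteq> \<bottom>))"

lemma rectangle_partition_swap:
  fixes R :: "('a::boolean_algebra \<times> 'b::boolean_algebra) set"
  assumes "rectangle_partition R"
  shows "rectangle_partition (prod.swap ` R)"
  unfolding rectangle_partition_def
proof (intro conjI allI impI)
  show "\<forall>p\<in>prod.swap ` R. fst p \<noteq> \<bottom> \<and> snd p \<noteq> \<bottom>"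
    using assms by (simp add: rectangle_partition_def)
  show "pairwise (\<lambda>p q. fst p \<sqinter> fst q = \<bottom> \<or> snd p \<sqinter> snd q = \<bottom>) (prod.swap ` R)"
    using assms by (fastforce simp: rectangle_partition_def pairwise_def)
next
  fix x :: 'b and y :: 'a assume "x \<noteq> \<bottom>" "y \<noteq> \<bottom>"
  then obtain p where "p \<in> R" "y \<sqinter> fst p \<noteq> \<bottom>" "x \<sqinter> snd p \<noteq> \<bottom>"
    using assms unfolding rectangle_partition_def by blast
  then show "\<exists>p\<in>prod.swap ` R. x \<sqinter> fst p \<noteq> \<bottom> \<and> y \<sqinter> snd p \<noteq> \<bottom>"
    by (intro bexI[of _ "prod.swap p"]) auto
qed

lemma rectangle_partition_eqI:
  assumes "rectangle_partition R" "p \<in> R" "q \<in> R"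
    "x \<noteq> \<bottom>" "x \<le> fst p" "x \<le> fst q" "y \<noteq> \<bottom>" "y \<le> snd p" "y \<le> snd q"
  shows "p = q"
proof -
  have "fst p \<sqinter> fst q \<noteq> \<bottom>" "snd p \<sqinter> snd q \<noteq> \<bottom>"
    using assms(4-) by (metis le_infI bot.extremum_uniqueI)+
  then show ?thesis
    using assms(1-3) by (auto simp: rectangle_partition_def pairwise_def)
qed

lemma escapable_mono:
  assumes "escapable TYPE('a::boolean_algebra) \<kappa>" "\<kappa>' \<le>o \<kappa>"
  shows "escapable TYPE('a) \<kappa>'"
  unfolding escapable_def
proof (intro allI impI)
  fix a :: "nat \<Rightarrow> 'a" and M E
  assume asm: "infinite M" "\<bottom> \<notin> a ` M" "pairwise (\<lambda>m n. a m \<sqinter> a n = \<bottom>) M"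
    "|E| \<le>o \<kappa>'" "\<forall>p\<in>E. finite {n \<in> M. a n \<sqinter> p \<noteq> \<bottom>}"
  show "\<exists>z. z \<noteq> \<bottom> \<and> (\<forall>p\<in>E. z \<sqinter> p = \<bottom>)"
  proof (rule escapableD[OF assms(1) asm(1) _ asm(3) ordLeq_transitive[OF asm(4) assms(2)]])
    show "a n \<noteq> \<bottom>" if "n \<in> M" for n
      using asm(2) that by (metis image_eqI)
  qed (use asm(5) in blast)
qed

text \<open>Let \<open>?M\<close> index the rectangles extending over \<open>v\<close>. A member of
  \<open>R\<close> whose first side meets \<open>v\<close> has a second side meeting at most one
  \<open>snd (r n)\<close> with \<open>n \<in> ?M\<close>, namely when it is \<open>r n\<close>
  itself. Escaping from these second sides gives \<open>z\<close>, and all of \<open>R\<close>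
  misses the rectangle \<open>v\<close> \<times> \<open>z\<close>.\<close>

lemma no_infinite_lower_bound:
  fixes R :: "('a::boolean_algebra \<times> 'b::boolean_algebra) set" and r :: "nat \<Rightarrow> 'a \<times> 'b"
  assumes R: "rectangle_partition R" and esc: "escapable TYPE('b) |R|"
    and r: "inj r" "range r \<subseteq> R" and v: "v \<noteq> \<bottom>" "infinite {n. v \<le> fst (r n)}"
  shows False
proof -
  let ?M = "{n. v \<le> fst (r n)}" and ?E = "snd ` {p \<in> R. v \<sqinter> fst p \<noteq> \<bottom>}"
  have eq: "r n = p" if "n \<in> ?M" "p \<in> R" "v \<sqinter> fst p \<noteq> \<bottom>" "snd (r n) \<sqinter> snd p \<noteq> \<bottom>" for n p
  proof (rule rectangle_partition_eqI[OF R _ that(2,3) _ _ that(4)])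
    show "r n \<in> R"
      using r(2) by blast
  qed (use that(1) in \<open>auto intro: le_infI1\<close>)
  have disj: "pairwise (\<lambda>m n. snd (r m) \<sqinter> snd (r n) = \<bottom>) ?M"
  proof (rule pairwiseI)
    fix m n assume mn: "m \<in> ?M" "n \<in> ?M" "m \<noteq> n"
    have "v \<sqinter> fst (r n) \<noteq> \<bottom>"
      using mn(2) v(1) by (simp add: inf.absorb1)
    then show "snd (r m) \<sqinter> snd (r n) = \<bottom>"
      using eq[OF mn(1), of "r n"] mn(3) r by (auto dest: injD)
  qed
  have small: "|?E| \<le>o |R|"
    by (rule ordLeq_transitive[OF card_of_image card_of_mono1]) simp
  have fin: "finite {n \<in> ?M. snd (r n) \<sqinter> q \<noteq> \<bottom>}" if q: "q \<in> ?E" for q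
  proof -
    obtain p where p: "p \<in> R" "v \<sqinter> fst p \<noteq> \<bottom>" "q = snd p"
      using q by blast
    then have "{n \<in> ?M. snd (r n) \<sqinter> q \<noteq> \<bottom>} \<subseteq> r -` {p}"
      using eq by blast
    then show ?thesis
      using finite_vimageI[OF _ r(1), of "{p}"] finite_subset by blast
  qed
  have nz: "snd (r n) \<noteq> \<bottom>" for n
    using R r(2) by (auto simp: rectangle_partition_def)
  obtain z where "z \<noteq> \<bottom>" "\<forall>p\<in>?E. z \<sqinter> p = \<bottom>"
    using escapableD[OF esc v(2) nz disj small fin] by blast
  then show False
    using R v(1) unfolding rectangle_partition_def by blast
qed

lemma no_infinite_lower_bound':
  fixes R :: "('a::boolean_algebra \<times> 'b::boolean_algebra) set" and r :: "nat \<Rightarrow> 'a \<times> 'b"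
  assumes R: "rectangle_partition R" and esc: "escapable TYPE('a) |R|"
    and r: "inj r" "range r \<subseteq> R" and v: "v \<noteq> \<bottom>" "infinite {n. v \<le> snd (r n)}"
  shows False
proof (rule no_infinite_lower_bound[OF rectangle_partition_swap[OF R] _ _ _ v(1)])
  show "escapable TYPE('a) |prod.swap ` R|"
    by (rule escapable_mono[OF esc card_of_image])
  show "inj (\<lambda>n. prod.swap (r n))" "range (\<lambda>n. prod.swap (r n)) \<subseteq> prod.swap ` R"
    using inj_compose[OF inj_swap r(1)] r(2) by (auto simp: comp_def)
  show "infinite {n. v \<le> fst (prod.swap (r n))}"
    using v(2) by simp
qed

lemma finite_infinite_rectangle_partition:
  fixes R :: "('a::boolean_algebra \<times> 'b::boolean_algebra) set"
  assumes R: "rectangle_partition R" and sc: "sigma_closed TYPE('a)"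
    and esc: "escapable TYPE('a) |R|" "escapable TYPE('b) |R|"
  shows "finite R"
proof (rule ccontr)
  assume "infinite R"
  then obtain r0 :: "nat \<Rightarrow> 'a \<times> 'b" where r0: "inj r0" "range r0 \<subseteq> R"
    unfolding infinite_iff_countable_subset by blast
  have nz: "fst p \<noteq> \<bottom>" "snd p \<noteq> \<bottom>" if "p \<in> R" for p
    using R that by (auto simp: rectangle_partition_def)
  obtain f a0 where f: "strict_mono (f :: nat \<Rightarrow> nat)"
    and a0: "\<And>k. a0 k \<noteq> \<bottom>" "\<And>k. a0 k \<le> fst (r0 (f k))"
      "pairwise (\<lambda>m n. a0 m \<sqinter> a0 n = \<bottom>) UNIV"
  proof (rule common_lower_bound_or_disjoint_shrinking[of "\<lambda>n. fst (r0 n)"])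
    show "fst (r0 n) \<noteq> \<bottom>" for n
      using nz r0 by blast
  next
    fix v assume "v \<noteq> \<bottom>" "infinite {n. v \<le> fst (r0 n)}"
    then show thesis
      using no_infinite_lower_bound[OF R esc(2) r0] by blast
  qed (rule that)
  obtain g b where g: "strict_mono (g :: nat \<Rightarrow> nat)"
    and b: "\<And>k. b k \<noteq> \<bottom>" "\<And>k. b k \<le> snd (r0 (f (g k)))"
      "pairwise (\<lambda>m n. b m \<sqinter> b n = \<bottom>) UNIV"
  proof (rule common_lower_bound_or_disjoint_shrinking[of "\<lambda>n. snd (r0 (f n))"])
    show "snd (r0 (f n)) \<noteq> \<bottom>" for n
      using nz r0 by blast
  next
    fix v assume v: "v \<noteq> \<bottom>" "infinite {n. v \<le> snd (r0 (f n))}"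
    have "inj (\<lambda>n. r0 (f n))"
      using r0(1) f by (auto simp: inj_def dest: strict_mono_eq)
    then show thesis
      using no_infinite_lower_bound'[OF R esc(1) _ _ v] r0(2) by blast
  qed (rule that)
  define a r where "a k = a0 (g k)" and "r k = r0 (f (g k))" for k
  have r: "inj r" "r k \<in> R" for k
    using r0 f g by (auto simp: inj_def r_def dest: strict_mono_eq)
  have a: "a k \<noteq> \<bottom>" "a k \<le> fst (r k)" "m \<noteq> n \<Longrightarrow> a m \<sqinter> a n = \<bottom>" for k m n
    using a0 strict_mono_eq[OF g, of m n] by (auto simp: a_def r_def pairwise_def)
  have b: "b k \<noteq> \<bottom>" "b k \<le> snd (r k)" "m \<noteq> n \<Longrightarrow> b m \<sqinter> b n = \<bottom>" for k m n
    using b by (auto simp: r_def pairwise_def)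
  \<comment> \<open>The rectangle \<open>a n\<close> \<times> \<open>b n\<close> lies inside
    \<open>r n\<close>, so a member \<open>p\<close> meeting both of its sides is
    \<open>r n\<close>; by injectivity this concerns at most one \<open>n\<close>.\<close>
  have both: "finite {n. a n \<sqinter> fst p \<noteq> \<bottom> \<and> b n \<sqinter> snd p \<noteq> \<bottom>}" if p: "p \<in> R" for p
  proof (rule finite_subset)
    show "{n. a n \<sqinter> fst p \<noteq> \<bottom> \<and> b n \<sqinter> snd p \<noteq> \<bottom>} \<subseteq> r -` {p}"
      using rectangle_partition_eqI[OF R r(2) p] a(2) b(2) by (fastforce intro: le_infI1)
    show "finite (r -` {p})"
      using r(1) by (simp add: finite_vimageI)
  qed
  \<comment> \<open>The successive cuts are collected in a single element \<open>u\<close>, the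
    current terms being \<open>a n \<sqinter> u\<close> for \<open>n \<in> M\<close>. The claim is
    that the cutting reaches a stage at which no member of \<open>R\<close> meets infinitely many
    terms on both sides.\<close>
  have tame: "\<exists>M u. infinite M \<and> (\<forall>n\<in>M. a n \<sqinter> u \<noteq> \<bottom>) \<and>
    (\<forall>p\<in>R. finite {n \<in> M. a n \<sqinter> u \<sqinter> fst p \<noteq> \<bottom>} \<or> finite {n \<in> M. b n \<sqinter> snd p \<noteq> \<bottom>})"
  proof (rule ccontr)
    assume "\<not> ?thesis"
    then have wild: "\<exists>p\<in>R. infinite {n \<in> M. a n \<sqinter> u \<sqinter> fst p \<noteq> \<bottom>} \<and> infinite {n \<in> M. b n \<sqinter> snd p \<noteq> \<bottom>}"
      if "infinite M" "\<forall>n\<in>M. a n \<sqinter> u \<noteq> \<bottom>" for M u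
      using that by blast
    define P where "P = (\<lambda>(M, u, p). p \<in> R \<and> infinite {n \<in> M. a n \<sqinter> u \<sqinter> fst p \<noteq> \<bottom>} \<and>
        infinite {n \<in> M. b n \<sqinter> snd p \<noteq> \<bottom>})"
    define Q :: "nat set \<times> 'a \<times> 'a \<times> 'b \<Rightarrow> nat set \<times> 'a \<times> 'a \<times> 'b \<Rightarrow> bool"
      where "Q = (\<lambda>(M, u, p) (M', u', p'). M' \<subseteq> M \<and> u' = u \<sqinter> fst p \<and> (\<forall>n\<in>M'. b n \<sqinter> snd p = \<bottom>))"
    have "\<exists>h. \<forall>n. P (h n) \<and> Q (h n) (h (Suc n))"
    proof (rule dependent_nat_choice)
      show "\<exists>x. P x"
      proof -
        obtain p where "P (UNIV, \<top>, p)"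
          using wild[of UNIV \<top>] a(1) by (auto simp: P_def)
        then show ?thesis ..
      qed
    next
      fix x and k :: nat assume "P x"
      obtain M u p where x: "x = (M, u, p)" by (cases x) auto
      \<comment> \<open>By \<open>both\<close>, only finitely many indices are removed here. At the
        remaining ones \<open>a n\<close> meets \<open>fst p\<close>, so \<open>b n\<close> misses
        \<open>snd p\<close>; this prevents \<open>p\<close> from being chosen again.\<close>
      let ?M = "{n \<in> M. a n \<sqinter> u \<sqinter> fst p \<noteq> \<bottom>} - {n. a n \<sqinter> fst p \<noteq> \<bottom> \<and> b n \<sqinter> snd p \<noteq> \<bottom>}"
      have "infinite ?M"
        using \<open>P x\<close> both[of p] by (auto simp: P_def x intro!: Diff_infinite_finite)
      moreover have "\<forall>n\<in>?M. a n \<sqinter> (u \<sqinter> fst p) \<noteq> \<bottom>"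
        by (simp add: inf_assoc)
      ultimately obtain q where q: "P (?M, u \<sqinter> fst p, q)"
        using wild[of ?M "u \<sqinter> fst p"] by (auto simp: P_def)
      have "b n \<sqinter> snd p = \<bottom>" if "n \<in> ?M" for n
      proof -
        have "a n \<sqinter> fst p \<noteq> \<bottom>"
        proof
          assume "a n \<sqinter> fst p = \<bottom>"
          then have "a n \<sqinter> u \<sqinter> fst p = \<bottom>"
            by (metis inf_assoc inf_bot_right inf_left_commute)
          with that show False by simp
        qed
        with that show ?thesis by blast
      qed
      then have "Q x (?M, u \<sqinter> fst p, q)"
        by (auto simp: Q_def x)
      with q show "\<exists>y. P y \<and> Q x y"
        by blast
    qed
    then obtain h where h: "\<And>n. P (h n)" "\<And>n. Q (h n) (h (Suc n))"
      by blast
    define M u p where "M n = fst (h n)" and "u n = fst (snd (h n))" and "p n = snd (snd (h n))" for n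
    have pR: "p n \<in> R" and u: "infinite {k \<in> M n. a k \<sqinter> u n \<sqinter> fst (p n) \<noteq> \<bottom>}"
      and pinf: "infinite {k \<in> M n. b k \<sqinter> snd (p n) \<noteq> \<bottom>}"
      and MS: "M (Suc n) \<subseteq> M n" and uS: "u (Suc n) = u n \<sqinter> fst (p n)"
      and pfin: "\<forall>k\<in>M (Suc n). b k \<sqinter> snd (p n) = \<bottom>" for n
      using h(1)[of n] h(2)[of n] by (auto simp: P_def Q_def M_def u_def p_def case_prod_beta)
    \<comment> \<open>After stage \<open>m\<close> no remaining \<open>b k\<close> meets
      \<open>snd (p m)\<close>, whereas \<open>snd (p n)\<close> meets infinitely many of those
      remaining at stage \<open>n\<close>.\<close>
    have "p m \<noteq> p n" if "m < n" for m n
    proof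
      assume "p m = p n"
      have "M n \<subseteq> M (Suc m)"
        using lift_Suc_antimono_le[of M "Suc m" n] MS that by simp
      then have "{k \<in> M n. b k \<sqinter> snd (p n) \<noteq> \<bottom>} = {}"
        using pfin[of m] \<open>p m = p n\<close> by auto
      with pinf[of n] show False by simp
    qed
    then have "inj p"
      by (metis injI nat_neq_iff)
    \<comment> \<open>The cuts decrease and are nonzero. A nonzero lower bound of them lies below
      the first sides of infinitely many distinct members of \<open>R\<close>, which is
      excluded.\<close>
    have "u n \<noteq> \<bottom>" for n
      using u[of n] by (auto dest!: infinite_imp_nonempty)
    then obtain v where v: "v \<noteq> \<bottom>" "\<And>n. v \<le> u n"
      using sigma_closedD[OF sc, of u] uS by auto
    have "v \<le> fst (p n)" for n
      using v(2)[of "Suc n"] by (simp add: uS)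
    then show False
      using no_infinite_lower_bound[OF R esc(2) \<open>inj p\<close> _ v(1)] pR by auto
  qed
  then obtain M u where M: "infinite M" "\<And>n. n \<in> M \<Longrightarrow> a n \<sqinter> u \<noteq> \<bottom>"
    "\<And>p. p \<in> R \<Longrightarrow> finite {n \<in> M. a n \<sqinter> u \<sqinter> fst p \<noteq> \<bottom>} \<or> finite {n \<in> M. b n \<sqinter> snd p \<noteq> \<bottom>}"
    by blast
  have leq: "|fst ` {p \<in> R. T p}| \<le>o |R|" "|snd ` {p \<in> R. T p}| \<le>o |R|" for T
    by (rule ordLeq_transitive[OF card_of_image card_of_mono1], simp)+
  have "a m \<sqinter> u \<sqinter> (a n \<sqinter> u) = \<bottom>" if "m \<noteq> n" for m n
    using a(3)[OF that] by (metis inf_assoc inf_bot_left inf_left_commute)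
  then have disj_a: "pairwise (\<lambda>m n. a m \<sqinter> u \<sqinter> (a n \<sqinter> u) = \<bottom>) M"
    by (simp add: pairwise_def)
  \<comment> \<open>Every member of \<open>R\<close> has finite trace on one of the two sequences.
    Choose \<open>x\<close> off the first sides with finite trace and, next, \<open>y\<close> off
    the second sides with finite trace; then \<open>R\<close> misses \<open>x\<close> \<times>
    \<open>y\<close>.\<close>
  have "\<exists>x. x \<noteq> \<bottom> \<and> (\<forall>q\<in>fst ` {p \<in> R. finite {n \<in> M. a n \<sqinter> u \<sqinter> fst p \<noteq> \<bottom>}}. x \<sqinter> q = \<bottom>)"
    by (rule escapableD[OF esc(1) M(1,2) disj_a leq(1)]) auto
  then obtain x where x: "x \<noteq> \<bottom>"
    "\<forall>p\<in>R. finite {n \<in> M. a n \<sqinter> u \<sqinter> fst p \<noteq> \<bottom>} \<longrightarrow> x \<sqinter> fst p = \<bottom>"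
    by blast
  have disj_b: "pairwise (\<lambda>m n. b m \<sqinter> b n = \<bottom>) M"
    using b(3) by (simp add: pairwise_def)
  have "\<exists>y. y \<noteq> \<bottom> \<and> (\<forall>q\<in>snd ` {p \<in> R. finite {n \<in> M. b n \<sqinter> snd p \<noteq> \<bottom>}}. y \<sqinter> q = \<bottom>)"
    by (rule escapableD[OF esc(2) M(1) b(1) disj_b leq(2)]) auto
  then obtain y where y: "y \<noteq> \<bottom>"
    "\<forall>p\<in>R. finite {n \<in> M. b n \<sqinter> snd p \<noteq> \<bottom>} \<longrightarrow> y \<sqinter> snd p = \<bottom>"
    by blast
  show False
    using R x y M(3) unfolding rectangle_partition_def by meson
qed

subsection \<open>Partitions and gaps\<close>

lemma least_card_attained:
  assumes "\<S> \<noteq> {}"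
  shows "\<exists>S\<in>\<S>. least_card \<S> = |S| \<and> (\<forall>T\<in>\<S>. |S| \<le>o |T| )"
proof -
  have "\<exists>r\<in>card_of ` \<S>. \<forall>r'\<in>card_of ` \<S>. r \<le>o r'"
    using assms by (intro exists_minim_Card_order) (auto simp: card_of_Card_order)
  then have "\<exists>S. S \<in> \<S> \<and> (\<forall>T\<in>\<S>. |S| \<le>o |T| )"
    by blast
  from someI_ex[OF this] show ?thesis
    unfolding least_card_def by blast
qed

lemma least_card_le:
  assumes "T \<in> \<S>"
  shows "least_card \<S> \<le>o |T|"
proof -
  have "\<S> \<noteq> {}"
    using assms by blast
  from least_card_attained[OF this] assms show ?thesis
    by auto
qed

lemma card_min_le:
  assumes "Card_order r" "Card_order s"
  shows "card_min r s \<le>o r" "card_min r s \<le>o s"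
proof -
  have r: "dir_image r Inl =o r"
    using dir_image[of Inl r] assms(1) ordIso_symmetric by fastforce
  have s: "dir_image s Inr =o s"
    using dir_image[of Inr s] assms(2) ordIso_symmetric by fastforce
  have total: "r \<le>o s \<or> s \<le>o r"
    using assms by (simp add: card_order_on_def ordLeq_total)
  show "card_min r s \<le>o r"
    using r s total ordIso_ordLeq_trans ordIso_imp_ordLeq unfolding card_min_def by auto
  show "card_min r s \<le>o s"
    using r s ordIso_ordLeq_trans ordIso_imp_ordLeq unfolding card_min_def by auto
qed

lemma card_of_image_infinite_nat:
  fixes M :: "nat set"
  assumes "infinite M" "inj_on f M"
  shows "|f ` M| =o natLeq"
proof -
  have "|f ` M| \<le>o |UNIV :: nat set|"
    using ordLeq_transitive[OF card_of_image card_of_mono1[OF subset_UNIV]] .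
  moreover have "|UNIV :: nat set| \<le>o |f ` M|"
    using assms by (simp add: infinite_iff_card_of_nat[symmetric] finite_image_iff)
  ultimately show ?thesis
    using card_of_nat ordIso_iff_ordLeq ordIso_transitive by blast
qed

lemma disjoint_inj_on:
  fixes a :: "'i \<Rightarrow> 'a::boolean_algebra"
  assumes "pairwise (\<lambda>m n. a m \<sqinter> a n = \<bottom>) M" "\<bottom> \<notin> a ` M"
  shows "inj_on a M"
proof (rule inj_onI, rule ccontr)
  fix m n assume mn: "m \<in> M" "n \<in> M" "a m = a n" "m \<noteq> n"
  then have "a m \<sqinter> a n = \<bottom>"
    using pairwiseD[OF assms(1)] by blast
  then have "a m = \<bottom>"
    using mn(3) by simp
  with mn(1) assms(2) show False
    by (metis image_eqI)
qed

lemma no_countable_partition: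
  fixes P :: "'a::boolean_algebra set"
  assumes "omega1 \<le>o cardinal_a TYPE('a)" "is_partition P" "infinite P"
  shows "\<not> |P| \<le>o natLeq"
proof
  assume le: "|P| \<le>o natLeq"
  have "cardinal_a TYPE('a) \<le>o |P|"
    unfolding cardinal_a_def using assms by (intro least_card_le) simp
  from ordLeq_transitive[OF ordLeq_transitive[OF assms(1) this] le] have "omega1 \<le>o natLeq" .
  then show False
    using not_ordLess_ordLeq[OF cardSuc_greater[OF natLeq_Card_order]] by simp
qed

text \<open>For a decreasing sequence without nonzero lower bound, the complement of its first term
  and the successive differences would form a countably infinite partition: an element disjoint from
  all of them is, by induction, below every \<open>d n\<close>.\<close>

lemma sigma_closedI:
  assumes "omega1 \<le>o cardinal_a TYPE('a::boolean_algebra)"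
  shows "sigma_closed TYPE('a)"
  unfolding sigma_closed_def
proof (intro allI impI)
  fix d :: "nat \<Rightarrow> 'a"
  assume d: "\<forall>n. d n \<noteq> \<bottom> \<and> d (Suc n) \<le> d n"
  have mono: "d n \<le> d m" if "m \<le> n" for m n
    using lift_Suc_antimono_le[of d m n] d that by simp
  show "\<exists>v. v \<noteq> \<bottom> \<and> (\<forall>n. v \<le> d n)"
  proof (rule ccontr)
    assume no: "\<not> ?thesis"
    define e where "e n = (case n of 0 \<Rightarrow> - d 0 | Suc m \<Rightarrow> d m \<sqinter> - d (Suc m))" for n
    \<comment> \<open>The sequence need not be strictly decreasing, so vanishing differences are
      left out.\<close>
    define M where "M = {n. e n \<noteq> \<bottom>}"
    have lt: "e m \<sqinter> e n = \<bottom>" if mn: "m < n" for m n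
    proof -
      obtain k where k: "n = Suc k"
        using mn by (cases n) auto
      have "e n \<le> d m"
        using mono[of m k] mn k by (simp add: e_def le_infI1)
      moreover have "e m \<le> - d m"
        by (cases m) (auto simp: e_def)
      ultimately have "e m \<sqinter> e n \<le> - d m \<sqinter> d m"
        by (rule inf_mono[rotated])
      then show ?thesis
        by (simp add: bot_unique)
    qed
    have disj: "pairwise (\<lambda>m n. e m \<sqinter> e n = \<bottom>) M"
      unfolding pairwise_def by (metis inf_commute lt nat_neq_iff)
    have inj: "inj_on e M"
      using disj by (rule disjoint_inj_on) (auto simp: M_def)
    \<comment> \<open>Otherwise the sequence is constant from some \<open>N\<close> on, and
      \<open>d N\<close> is a nonzero lower bound.\<close>
    have "infinite M"
    proof
      assume "finite M"
      then obtain N where N: "\<forall>n\<in>M. n \<le> N"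
        unfolding finite_nat_set_iff_bounded_le by blast
      have tail: "d N \<le> d (N + k)" for k
      proof (induction k)
        case (Suc k)
        have "e (Suc (N + k)) = \<bottom>"
          using N unfolding M_def by force
        then have "d (N + k) \<le> d (Suc (N + k))"
          by (simp add: e_def inf_shunt)
        with Suc show ?case by simp
      qed simp
      then have "d N \<le> d n" for n
        using mono[of n N] tail[of "n - N"] by (cases "n \<le> N") auto
      with no d show False by blast
    qed
    have "is_partition (e ` M)"
      unfolding is_partition_def
    proof (intro conjI allI impI)
      show "\<bottom> \<notin> e ` M"
        by (auto simp: M_def)
      show "pairwise (\<lambda>p q. p \<sqinter> q = \<bottom>) (e ` M)"
        using disj by (auto simp: pairwise_def)
      fix x :: 'a assume x: "x \<noteq> \<bottom>"
      show "\<exists>p\<in>e ` M. x \<sqinter> p \<noteq> \<bottom>"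
      proof (rule ccontr)
        assume "\<not> ?thesis"
        then have xe: "x \<sqinter> e n = \<bottom>" for n
          by (cases "n \<in> M") (auto simp: M_def)
        have zero: "x \<sqinter> - d 0 = \<bottom>"
          using xe[of 0] by (simp add: e_def)
        have suc: "x \<sqinter> (d n \<sqinter> - d (Suc n)) = \<bottom>" for n
          using xe[of "Suc n"] by (simp add: e_def)
        have "x \<le> d n" for n
        proof (induction n)
          case 0
          then show ?case using zero by (simp add: inf_shunt)
        next
          case (Suc n)
          with suc[of n] have "x \<sqinter> - d (Suc n) = \<bottom>"
            by (simp add: inf.absorb1 inf_assoc[symmetric])
          then show ?case by (simp add: inf_shunt)
        qed
        with no x show False by blast
      qed
    qed
    moreover have "infinite (e ` M)" "|e ` M| \<le>o natLeq"
      using \<open>infinite M\<close> inj card_of_image_infinite_nat ordIso_imp_ordLeq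
      by (auto simp: finite_image_iff)
    ultimately show False
      using no_countable_partition assms by blast
  qed
qed

lemma escapable_if_no_gap:
  assumes a: "omega1 \<le>o cardinal_a TYPE('a::boolean_algebra)"
    and gap: "\<And>\<A> \<B> :: 'a set. rothberger_gap \<A> \<B> \<Longrightarrow> \<not> |\<B>| \<le>o \<kappa>"
  shows "escapable TYPE('a) \<kappa>"
proof (rule escapableI[OF sigma_closedI[OF a]])
  fix a :: "nat \<Rightarrow> 'a" and M \<B>
  assume M: "infinite M" "\<bottom> \<notin> a ` M" "pairwise (\<lambda>m n. a m \<sqinter> a n = \<bottom>) M"
    and \<B>: "|\<B>| \<le>o \<kappa>" "\<forall>n\<in>M. \<forall>b\<in>\<B>. a n \<sqinter> b = \<bottom>"
  have card: "|a ` M| =o natLeq"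
    using card_of_image_infinite_nat[OF M(1) disjoint_inj_on[OF M(3,2)]] .
  have "|\<B> - {\<bottom>}| \<le>o \<kappa>"
    using ordLeq_transitive[OF card_of_mono1 \<B>(1), of "\<B> - {\<bottom>}"] by blast
  then have ngap: "\<not> rothberger_gap (a ` M) (\<B> - {\<bottom>})"
    using gap by blast
  show "\<exists>c. (\<forall>n\<in>M. a n \<sqinter> c = \<bottom>) \<and> (\<forall>b\<in>\<B>. b \<le> c)"
  \<comment> \<open>Gaps have a nonempty second side of nonzero elements, so \<bottom> is removed
    from \<open>\<B>\<close>; if nothing is left, \<open>c = \<bottom>\<close> separates.\<close>
  proof (cases "\<B> \<subseteq> {\<bottom>}")
    case True
    then show ?thesis by (intro exI[of _ \<bottom>]) auto
  next
    case False
    then obtain c where "\<forall>x\<in>a ` M. x \<sqinter> c = \<bottom>" "\<forall>b\<in>\<B> - {\<bottom>}. b \<le> c"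
      using ngap M(2) card \<B>(2) unfolding rothberger_gap_def by blast
    then show ?thesis
      by (intro exI[of _ c]) (metis DiffI bot.extremum image_eqI singletonD)
  qed
qed

text \<open>This makes \<open>cardinal_a\<close> of an infinite algebra an attained minimum. Halving
  an element with infinitely many elements below it leaves a half of the same kind; the resulting
  strictly decreasing sequence has disjoint nonzero differences, which Zorn's lemma extends to a
  partition.\<close>

lemma infinite_partition_exists:
  assumes "infinite (UNIV :: 'a::boolean_algebra set)"
  shows "\<exists>P :: 'a set. is_partition P \<and> infinite P"
proof -
  have split: "\<exists>y. y < x \<and> infinite {z. z \<le> y}" if x: "infinite {z. z \<le> x}" for x :: 'a
  proof -
    have "infinite ({z. z \<le> x} - {\<bottom>, x})"
      using x by simp
    from infinite_imp_nonempty[OF this] obtain y where y: "y \<le> x" "y \<noteq> \<bottom>" "y \<noteq> x"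
      by blast
    \<comment> \<open>An element below \<open>x\<close> is determined by its parts inside and
      outside \<open>y\<close>, so one of the two halves has infinitely many elements below
      it.\<close>
    have "{z. z \<le> x} \<subseteq> (\<lambda>(u, v). u \<squnion> v) ` ({z. z \<le> y} \<times> {z. z \<le> x \<sqinter> - y})"
    proof
      fix z assume "z \<in> {z. z \<le> x}"
      then have "z = (z \<sqinter> y) \<squnion> (z \<sqinter> - y)" "z \<sqinter> y \<le> y" "z \<sqinter> - y \<le> x \<sqinter> - y"
        by (simp_all add: inf_sup_distrib1[symmetric] le_infI1)
      then show "z \<in> (\<lambda>(u, v). u \<squnion> v) ` ({z. z \<le> y} \<times> {z. z \<le> x \<sqinter> - y})"
        by force
    qed
    then have "infinite {z. z \<le> y} \<or> infinite {z. z \<le> x \<sqinter> - y}"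
      using x finite_subset finite_imageI finite_cartesian_product by metis
    moreover have "y < x" "x \<sqinter> - y < x"
    proof -
      show "y < x" using y by simp
      have "x \<sqinter> - y \<noteq> x"
      proof
        assume "x \<sqinter> - y = x"
        then have "y \<le> - y"
          using y(1) by (metis inf.cobounded2 order_trans)
        then show False using y(2) by (metis inf.absorb1 inf_compl_bot)
      qed
      then show "x \<sqinter> - y < x" by (simp add: less_le)
    qed
    ultimately show ?thesis by blast
  qed
  have "\<exists>d. \<forall>n::nat. infinite {z. z \<le> d n} \<and> d (Suc n) < (d n :: 'a)"
    by (rule dependent_nat_choice) (use assms split in \<open>auto intro: exI[of _ \<top>]\<close>)
  then obtain d :: "nat \<Rightarrow> 'a" where d: "\<And>n. d (Suc n) < d n"
    by blast
  define e where "e n = d n \<sqinter> - d (Suc n)" for n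
  have nz: "e n \<noteq> \<bottom>" for n
    using d[of n] by (auto simp: e_def inf_shunt less_le_not_le)
  have lt: "e m \<sqinter> e n = \<bottom>" if "m < n" for m n
  proof -
    have "d n \<le> d (Suc m)"
      using lift_Suc_antimono_le[of d "Suc m" n] d that by (simp add: less_imp_le)
    then have "e m \<sqinter> e n \<le> - d (Suc m) \<sqinter> d (Suc m)"
      unfolding e_def by (intro inf_mono) (auto intro: le_infI1)
    then show ?thesis by (simp add: bot_unique)
  qed
  have disj: "pairwise (\<lambda>m n. e m \<sqinter> e n = \<bottom>) UNIV"
    unfolding pairwise_def by (metis inf_commute lt nat_neq_iff)
  define \<F> where "\<F> = {P. range e \<subseteq> P \<and> \<bottom> \<notin> P \<and> pairwise (\<lambda>p q. p \<sqinter> q = \<bottom>) P}"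
  have "range e \<in> \<F>"
    using nz disj by (auto simp: \<F>_def pairwise_def) metis+
  then have "\<F> \<noteq> {}" by blast
  then have "\<exists>P\<in>\<F>. \<forall>X\<in>\<F>. P \<subseteq> X \<longrightarrow> X = P"
  proof (rule subset_Zorn_nonempty)
    fix \<C> assume C: "\<C> \<noteq> {}" "subset.chain \<F> \<C>"
    have "pairwise (\<lambda>p q. p \<sqinter> q = \<bottom>) (\<Union>\<C>)"
    proof (rule pairwiseI)
      fix p q assume pq: "p \<in> \<Union>\<C>" "q \<in> \<Union>\<C>" "p \<noteq> q"
      then obtain X Y where "X \<in> \<C>" "Y \<in> \<C>" "p \<in> X" "q \<in> Y" by blast
      then obtain Z where "Z \<in> \<C>" "p \<in> Z" "q \<in> Z"
        using C(2) unfolding subset.chain_def by blast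
      then show "p \<sqinter> q = \<bottom>"
        using C(2) pq(3) unfolding subset.chain_def \<F>_def pairwise_def by blast
    qed
    then show "\<Union>\<C> \<in> \<F>"
      using C unfolding subset.chain_def \<F>_def by blast
  qed
  then obtain P where P: "P \<in> \<F>" "\<And>X. X \<in> \<F> \<Longrightarrow> P \<subseteq> X \<Longrightarrow> X = P"
    by blast
  have "is_partition P"
    unfolding is_partition_def
  proof (intro conjI allI impI)
    fix x :: 'a assume x: "x \<noteq> \<bottom>"
    show "\<exists>p\<in>P. x \<sqinter> p \<noteq> \<bottom>"
    proof (rule ccontr)
      assume no: "\<not> ?thesis"
      then have "insert x P \<in> \<F>"
        using P(1) x by (auto simp: \<F>_def pairwise_insert inf_commute)
      then have "x \<in> P" using P(2) by blast
      with no x show False by auto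
    qed
  qed (use P(1) in \<open>auto simp: \<F>_def\<close>)
  moreover have "infinite P"
  proof -
    have "inj e" by (rule disjoint_inj_on[OF disj]) (metis nz rangeE)
    then have "infinite (range e)" using finite_imageD infinite_UNIV_nat by blast
    then show ?thesis using P(1) finite_subset by (auto simp: \<F>_def)
  qed
  ultimately show ?thesis by blast
qed

subsection \<open>Rectangles in the free product\<close>

inductive_set rectangle_sums :: "('a \<Rightarrow> 'c::boolean_algebra) \<Rightarrow> ('b \<Rightarrow> 'c) \<Rightarrow> 'c set"
  for i j where
  zero: "\<bottom> \<in> rectangle_sums i j"
| add: "c \<in> rectangle_sums i j \<Longrightarrow> i a \<sqinter> j b \<sqinter> c = \<bottom> \<Longrightarrow> (i a \<sqinter> j b) \<squnion> c \<in> rectangle_sums i j"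

text \<open>The last two clauses say that \<open>c\<close> is the join of the rectangles in
  \<open>F\<close>; the covering half is phrased through meeting, as in
  \<open>is_partition\<close>.\<close>

definition decomposes ::
  "('a::boolean_algebra \<Rightarrow> 'c::boolean_algebra) \<Rightarrow> ('b::boolean_algebra \<Rightarrow> 'c) \<Rightarrow> ('a \<times> 'b) set \<Rightarrow> 'c \<Rightarrow> bool"
  where "decomposes i j F c \<longleftrightarrow>
    finite F \<and> (\<forall>p\<in>F. fst p \<noteq> \<bottom> \<and> snd p \<noteq> \<bottom>) \<and>
    pairwise (\<lambda>p q. fst p \<sqinter> fst q = \<bottom> \<or> snd p \<sqinter> snd q = \<bottom>) F \<and>
    (\<forall>p\<in>F. i (fst p) \<sqinter> j (snd p) \<le> c) \<and>
    (\<forall>y. y \<sqinter> c \<noteq> \<bottom> \<longrightarrow> (\<exists>p\<in>F. y \<sqinter> (i (fst p) \<sqinter> j (snd p)) \<noteq> \<bottom>))"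

context
  fixes i :: "'a::boolean_algebra \<Rightarrow> 'c::boolean_algebra" and j :: "'b::boolean_algebra \<Rightarrow> 'c"
  assumes fp: "is_free_product i j"
begin

lemma i_hom: "i \<bottom> = \<bottom>" "i \<top> = \<top>" "i (x \<sqinter> y) = i x \<sqinter> i y" "i (- x) = - i x" "inj i"
  and j_hom: "j \<bottom> = \<bottom>" "j \<top> = \<top>" "j (u \<sqinter> v) = j u \<sqinter> j v" "j (- u) = - j u"
  using fp by (auto simp: is_free_product_def boolean_embedding_def)

lemma rectangle_eq_bot_iff: "i x \<sqinter> j y = \<bottom> \<longleftrightarrow> x = \<bottom> \<or> y = \<bottom>"
  using fp i_hom(1) j_hom(1) unfolding is_free_product_def by (metis inf_bot_left inf_bot_right)

lemma rectangle_inf: "i x \<sqinter> j y \<sqinter> (i x' \<sqinter> j y') = i (x \<sqinter> x') \<sqinter> j (y \<sqinter> y')"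
  by (simp add: i_hom j_hom inf_assoc inf_left_commute)

lemma rectangle_sums_sup:
  "c \<in> rectangle_sums i j \<Longrightarrow> d \<in> rectangle_sums i j \<Longrightarrow> c \<sqinter> d = \<bottom> \<Longrightarrow> c \<squnion> d \<in> rectangle_sums i j"
proof (induction rule: rectangle_sums.induct)
  case zero
  then show ?case by simp
next
  case (add c a b)
  have "i a \<sqinter> j b \<sqinter> d = \<bottom>" "c \<sqinter> d = \<bottom>"
    using add.prems(2) by (simp_all add: inf_sup_distrib2)
  then have "(i a \<sqinter> j b) \<squnion> (c \<squnion> d) \<in> rectangle_sums i j"
    using add by (intro rectangle_sums.add) (simp_all add: inf_sup_distrib1)
  then show ?case by (simp add: sup_assoc)
qed

lemma rectangle_in_sums: "i a \<sqinter> j b \<in> rectangle_sums i j"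
  using rectangle_sums.add[OF rectangle_sums.zero, of i a j b] by simp

lemma rectangle_sums_inf_rectangle:
  "c \<in> rectangle_sums i j \<Longrightarrow> i a \<sqinter> j b \<sqinter> c \<in> rectangle_sums i j"
proof (induction rule: rectangle_sums.induct)
  case zero
  then show ?case by (simp add: rectangle_sums.zero)
next
  case (add c a' b')
  have "i (a \<sqinter> a') \<sqinter> j (b \<sqinter> b') \<squnion> (i a \<sqinter> j b \<sqinter> c) \<in> rectangle_sums i j"
  proof (rule rectangle_sums.add[OF add.IH])
    have "i (a \<sqinter> a') \<sqinter> j (b \<sqinter> b') \<sqinter> (i a \<sqinter> j b \<sqinter> c) \<le> i a' \<sqinter> j b' \<sqinter> c"
      by (simp add: i_hom j_hom le_infI1 le_infI2)
    then show "i (a \<sqinter> a') \<sqinter> j (b \<sqinter> b') \<sqinter> (i a \<sqinter> j b \<sqinter> c) = \<bottom>"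
      using add.hyps(2) by (simp add: bot_unique)
  qed
  then show ?case
    by (simp add: rectangle_inf inf_sup_distrib1)
qed

lemma rectangle_sums_inf:
  "d \<in> rectangle_sums i j \<Longrightarrow> c \<in> rectangle_sums i j \<Longrightarrow> d \<sqinter> c \<in> rectangle_sums i j"
proof (induction rule: rectangle_sums.induct)
  case zero
  then show ?case by (simp add: rectangle_sums.zero)
next
  case (add d a b)
  have "i a \<sqinter> j b \<sqinter> c \<sqinter> (d \<sqinter> c) \<le> i a \<sqinter> j b \<sqinter> d"
    by (simp add: le_infI1 le_infI2)
  then have "i a \<sqinter> j b \<sqinter> c \<sqinter> (d \<sqinter> c) = \<bottom>"
    using add.hyps(2) by (simp add: bot_unique)
  then have "(i a \<sqinter> j b \<sqinter> c) \<squnion> (d \<sqinter> c) \<in> rectangle_sums i j"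
    using add by (intro rectangle_sums_sup rectangle_sums_inf_rectangle) auto
  then show ?case by (simp add: inf_sup_distrib2)
qed

lemma rectangle_sums_compl: "c \<in> rectangle_sums i j \<Longrightarrow> - c \<in> rectangle_sums i j"
proof (induction rule: rectangle_sums.induct)
  case zero
  then show ?case using rectangle_in_sums[of \<top> \<top>] by (simp add: i_hom j_hom)
next
  case (add c a b)
  \<comment> \<open>The complement of a rectangle splits into two disjoint rectangles: the full
    strip outside \<open>a\<close>, and the part over \<open>a\<close> outside
    \<open>b\<close>.\<close>
  have "(i (- a) \<sqinter> j \<top>) \<squnion> (i a \<sqinter> j (- b)) \<in> rectangle_sums i j"
    by (intro rectangle_sums_sup rectangle_in_sums) (simp add: rectangle_inf rectangle_eq_bot_iff)
  moreover have "(i (- a) \<sqinter> j \<top>) \<squnion> (i a \<sqinter> j (- b)) = - (i a \<sqinter> j b)"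
    by (simp add: i_hom j_hom sup_inf_distrib1)
  ultimately show ?case
    using rectangle_sums_inf add.IH by simp
qed

text \<open>The disjoint sums form a subalgebra containing both factors, as rectangles with one side
  \<top>, so they exhaust the generated algebra.\<close>

lemma rectangle_sums_UNIV: "c \<in> rectangle_sums i j"
proof -
  have "c \<in> generated_subalgebra (range i \<union> range j)"
    using fp by (simp add: is_free_product_def)
  then show ?thesis
  proof induction
    case (base x)
    then show ?case
      using rectangle_in_sums[of _ \<top>] rectangle_in_sums[of \<top>] by (auto simp: i_hom j_hom)
  qed (auto intro: rectangle_sums.zero rectangle_sums_compl rectangle_sums_inf)
qed

lemma rectangle_decomposition:
  "\<exists>F. decomposes i j F c"
  unfolding decomposes_def
  using rectangle_sums_UNIV[of c]
proof induction
  case zero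
  then show ?case by (intro exI[of _ "{}"]) auto
next
  case (add c a b)
  then obtain F where F: "finite F" "\<forall>p\<in>F. fst p \<noteq> \<bottom> \<and> snd p \<noteq> \<bottom>"
    "pairwise (\<lambda>p q. fst p \<sqinter> fst q = \<bottom> \<or> snd p \<sqinter> snd q = \<bottom>) F"
    "\<forall>p\<in>F. i (fst p) \<sqinter> j (snd p) \<le> c"
    "\<forall>y. y \<sqinter> c \<noteq> \<bottom> \<longrightarrow> (\<exists>p\<in>F. y \<sqinter> (i (fst p) \<sqinter> j (snd p)) \<noteq> \<bottom>)"
    by blast
  show ?case
  \<comment> \<open>A zero summand contributes nothing and is dropped, since
    \<open>decomposes\<close> admits only nonzero sides.\<close>
  proof (cases "a = \<bottom> \<or> b = \<bottom>")
    case True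
    then have "i a \<sqinter> j b = \<bottom>"
      by (simp add: rectangle_eq_bot_iff)
    with F show ?thesis by auto
  next
    case False
    have disj: "a \<sqinter> fst p = \<bottom> \<or> b \<sqinter> snd p = \<bottom>" if "p \<in> F" for p
    proof -
      have "i a \<sqinter> j b \<sqinter> (i (fst p) \<sqinter> j (snd p)) \<le> i a \<sqinter> j b \<sqinter> c"
        using F(4) that by (intro inf_mono) auto
      then show ?thesis
        using add.hyps(2) by (simp add: bot_unique rectangle_inf rectangle_eq_bot_iff)
    qed
    show ?thesis
    proof (intro exI[of _ "insert (a, b) F"] conjI)
      show "pairwise (\<lambda>p q. fst p \<sqinter> fst q = \<bottom> \<or> snd p \<sqinter> snd q = \<bottom>) (insert (a, b) F)"
        using F(3) disj by (auto simp: pairwise_insert inf_commute)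
      show "\<forall>p\<in>insert (a, b) F. i (fst p) \<sqinter> j (snd p) \<le> i a \<sqinter> j b \<squnion> c"
        using F(4) by (auto intro: le_supI2)
      show "\<forall>y. y \<sqinter> (i a \<sqinter> j b \<squnion> c) \<noteq> \<bottom> \<longrightarrow>
          (\<exists>p\<in>insert (a, b) F. y \<sqinter> (i (fst p) \<sqinter> j (snd p)) \<noteq> \<bottom>)"
        using F(5) by (auto simp: inf_sup_distrib1)
    qed (use F False in auto)
  qed
qed

text \<open>Decompose each member of \<open>P\<close> separately. Rectangles below different members
  are disjoint, and replacing each point of an infinite set by a finite set does not increase
  cardinality.\<close>

lemma partition_refinement:
  fixes P :: "'c set"
  assumes P: "is_partition P" "infinite P"
  obtains R :: "('a \<times> 'b) set" where "rectangle_partition R" "infinite R" "|R| \<le>o |P|"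
proof -
  obtain F where "\<And>c. decomposes i j (F c) c"
    using rectangle_decomposition by metis
  then have F: "finite (F c)" "p \<in> F c \<Longrightarrow> fst p \<noteq> \<bottom> \<and> snd p \<noteq> \<bottom>"
    "pairwise (\<lambda>p q. fst p \<sqinter> fst q = \<bottom> \<or> snd p \<sqinter> snd q = \<bottom>) (F c)"
    "p \<in> F c \<Longrightarrow> i (fst p) \<sqinter> j (snd p) \<le> c"
    "y \<sqinter> c \<noteq> \<bottom> \<Longrightarrow> \<exists>p\<in>F c. y \<sqinter> (i (fst p) \<sqinter> j (snd p)) \<noteq> \<bottom>" for c p y
    unfolding decomposes_def by blast+
  have cross: "fst p \<sqinter> fst q = \<bottom> \<or> snd p \<sqinter> snd q = \<bottom>"
    if "c \<in> P" "d \<in> P" "c \<noteq> d" "p \<in> F c" "q \<in> F d" for c d p q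
  proof -
    have "i (fst p) \<sqinter> j (snd p) \<sqinter> (i (fst q) \<sqinter> j (snd q)) \<le> c \<sqinter> d"
      using F(4) that by (intro inf_mono)
    also have "c \<sqinter> d = \<bottom>"
      using P(1) that by (auto simp: is_partition_def pairwise_def)
    finally show ?thesis
      by (simp add: bot_unique rectangle_inf rectangle_eq_bot_iff)
  qed
  let ?R = "\<Union>c\<in>P. F c"
  have "rectangle_partition ?R"
    unfolding rectangle_partition_def
  proof (intro conjI allI impI)
    show "\<forall>p\<in>?R. fst p \<noteq> \<bottom> \<and> snd p \<noteq> \<bottom>"
      using F(2) by blast
    show "pairwise (\<lambda>p q. fst p \<sqinter> fst q = \<bottom> \<or> snd p \<sqinter> snd q = \<bottom>) ?R"
    proof (rule pairwiseI)
      fix p q assume "p \<in> ?R" "q \<in> ?R" "p \<noteq> q"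
      then obtain c d where "c \<in> P" "d \<in> P" "p \<in> F c" "q \<in> F d"
        by blast
      then show "fst p \<sqinter> fst q = \<bottom> \<or> snd p \<sqinter> snd q = \<bottom>"
        using cross F(3)[of c] \<open>p \<noteq> q\<close> by (cases "c = d") (auto simp: pairwise_def)
    qed
    fix x :: 'a and y :: 'b assume "x \<noteq> \<bottom>" "y \<noteq> \<bottom>"
    then have "i x \<sqinter> j y \<noteq> \<bottom>"
      by (simp add: rectangle_eq_bot_iff)
    then obtain c where c: "c \<in> P" "i x \<sqinter> j y \<sqinter> c \<noteq> \<bottom>"
      using P(1) unfolding is_partition_def by blast
    then obtain p where "p \<in> F c" "i x \<sqinter> j y \<sqinter> (i (fst p) \<sqinter> j (snd p)) \<noteq> \<bottom>"
      using F(5) by blast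
    with c(1) show "\<exists>p\<in>?R. x \<sqinter> fst p \<noteq> \<bottom> \<and> y \<sqinter> snd p \<noteq> \<bottom>"
      by (auto simp: rectangle_inf rectangle_eq_bot_iff)
  qed
  moreover have "infinite ?R"
  proof
    assume "finite ?R"
    \<comment> \<open>The sets \<open>F c\<close> are nonempty and disjoint for different
      \<open>c\<close>, so \<open>F\<close> is injective on the infinite set \<open>P\<close>, while
      a finite union has only finitely many subsets.\<close>
    have "F c \<noteq> {}" if "c \<in> P" for c
      using F(5)[of c c] that P(1) by (auto simp: is_partition_def)
    moreover have "F c \<inter> F d = {}" if "c \<in> P" "d \<in> P" "c \<noteq> d" for c d
      using cross[OF that] F(2) by fastforce
    ultimately have "inj_on F P"
      by (metis inf.idem inj_onI)
    moreover have "finite (F ` P)"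
      using finite_UnionD[OF \<open>finite ?R\<close>] .
    ultimately show False
      using P(2) finite_imageD by blast
  qed
  moreover have "|?R| \<le>o |P|"
  proof (rule card_of_UNION_ordLeq_infinite[OF P(2)])
    have "|F c| <o natLeq" for c
      using F(1) by (simp add: finite_iff_ordLess_natLeq[symmetric])
    moreover have "natLeq \<le>o |P|"
      using P(2) infinite_iff_natLeq_ordLeq by blast
    ultimately show "\<forall>c\<in>P. |F c| \<le>o |P|"
      using ordLess_ordLeq_trans ordLess_imp_ordLeq by metis
  qed (rule card_of_mono1, simp)
  ultimately show ?thesis
    using that by blast
qed

end

theorem theorem3:
  fixes i :: "'a::boolean_algebra \<Rightarrow> 'c::boolean_algebra"
    and j :: "'b::boolean_algebra \<Rightarrow> 'c"
  assumes "infinite (UNIV :: 'a set)" and "infinite (UNIV :: 'b set)"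
    and "is_free_product i j"
    and "omega1 \<le>o cardinal_a TYPE('a)" and "omega1 \<le>o cardinal_a TYPE('b)"
  shows "card_min (cardinal_b TYPE('a)) (cardinal_b TYPE('b)) \<le>o cardinal_a TYPE('c)"
proof -
  have "inj i"
    using i_hom(5)[OF assms(3)] .
  then have "infinite (UNIV :: 'c set)"
    using assms(1) by (metis finite_imageD finite_subset subset_UNIV)
  \<comment> \<open>Nonemptiness turns the choice inside \<open>least_card\<close> into an actual
    partition of least size.\<close>
  then have "{P :: 'c set. is_partition P \<and> infinite P} \<noteq> {}"
    using infinite_partition_exists by blast
  from least_card_attained[OF this] obtain P :: "'c set"
    where P: "is_partition P" "infinite P" "cardinal_a TYPE('c) = |P|"
    unfolding cardinal_a_def by blast
  obtain R :: "('a \<times> 'b) set" where R: "rectangle_partition R" "infinite R" "|R| \<le>o |P|"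
    using partition_refinement[OF assms(3) P(1,2)] by blast
  have "(\<exists>\<A> \<B> :: 'a set. rothberger_gap \<A> \<B> \<and> |\<B>| \<le>o |R| ) \<or>
    (\<exists>\<A> \<B> :: 'b set. rothberger_gap \<A> \<B> \<and> |\<B>| \<le>o |R| )"
  proof (rule ccontr)
    assume "\<not> ?thesis"
    then have "escapable TYPE('a) |R|" "escapable TYPE('b) |R|"
      using escapable_if_no_gap assms(4,5) by blast+
    then show False
      using finite_infinite_rectangle_partition[OF R(1) sigma_closedI[OF assms(4)]] R(2) by blast
  qed
  then have "cardinal_b TYPE('a) \<le>o |P| \<or> cardinal_b TYPE('b) \<le>o |P|"
  proof (elim disjE exE conjE)
    fix \<A> \<B> :: "'a set" assume \<B>: "rothberger_gap \<A> \<B>" "|\<B>| \<le>o |R|"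
    have "cardinal_b TYPE('a) \<le>o |\<B>|"
      unfolding cardinal_b_def using \<B>(1) by (intro least_card_le) blast
    from ordLeq_transitive[OF ordLeq_transitive[OF this \<B>(2)] R(3)] show ?thesis ..
  next
    fix \<A> \<B> :: "'b set" assume \<B>: "rothberger_gap \<A> \<B>" "|\<B>| \<le>o |R|"
    have "cardinal_b TYPE('b) \<le>o |\<B>|"
      unfolding cardinal_b_def using \<B>(1) by (intro least_card_le) blast
    from ordLeq_transitive[OF ordLeq_transitive[OF this \<B>(2)] R(3)] show ?thesis ..
  qed
  moreover have card: "Card_order (cardinal_b TYPE('a))" "Card_order (cardinal_b TYPE('b))"
    by (simp_all add: cardinal_b_def least_card_def card_of_Card_order)
  ultimately show ?thesis
    unfolding P(3) by (elim disjE) (blast intro: ordLeq_transitive[OF card_min_le(1)[OF card]]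
      ordLeq_transitive[OF card_min_le(2)[OF card]])+
qed

end
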